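(* Let $\Omega$ be a Polish space with Borel $\sigma$-algebra $\mathcal F$, and let $\varrho\colon \mathrm{L}_{\mathrm b}\to[0,1]$ be a submodular default risk measure with \[ \varrho(X)=\varrho\big(\mathbf 1_{\{X>0\}}\big)\quad\text{for all }X\in \mathrm{L}_{\mathrm b}\text{ with }X\ge 0. \] Then the following statements are equivalent. \begin{enumerate} \item[(i)] $\varrho$ is continuous from below, i.e., $\varrho(X)=\lim_{n\to\infty}\varrho(X_n)$ for every sequence $(X_n)_{n\in\mathbb{N}}\subset \mathrm{L}_{\mathrm b}$ with $X_n\nearrow X\in \mathrm{L}_{\mathrm b}$ as $n\to\infty$. \item[(ii)] There exists a nonempty set $\mathcal P$ of (countably additive) probability measures on $(\Omega,\mathcal F)$ such that \[ \varrho(X)=\sup_{\mathbb{Q}\in\mathcal P}\mathbb{Q}(X>0)\quad\text{for all }X\in \mathrm{L}_{\mathrm b}. \] \end{enumerate}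
   Context: $\mathrm{L}_{\mathrm b}$ is the space of all bounded lower semicontinuous functions $\Omega\to\mathbb{R}$, ordered pointwise; $X\vee Y$ and $X\wedge Y$ denote pointwise maximum and minimum; real constants are identified with constant functions. $X_n\nearrow X$ means $X_n\le X_{n+1}$ for all $n$ and $X(\omega)=\lim_{n\to\infty}X_n(\omega)$ for all $\omega\in\Omega$. A map $\varrho\colon \mathrm{L}_{\mathrm b}\to[0,1]$ is a default risk measure if (i) $\varrho(X)\le\varrho(Y)$ for all $X,Y\in \mathrm{L}_{\mathrm b}$ with $X\le Y$, and (ii) $\varrho(0)=0$ and $\varrho(m)=1$ for all real $m>0$. It is submodular if $\varrho(X\wedge Y)+\varrho(X\vee Y)\le\varrho(X)+\varrho(Y)$ for all $X,Y\in \mathrm{L}_{\mathrm b}$. *)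

theory Defs
  imports "HOL-Probability.Probability"
begin

definition lower_semicontinuous :: "('a::topological_space \<Rightarrow> real) \<Rightarrow> bool" where
  "lower_semicontinuous X \<longleftrightarrow> (\<forall>\<omega>. \<forall>a < X \<omega>. \<forall>\<^sub>F \<eta> in nhds \<omega>. a < X \<eta>)"

lemma lower_semicontinuous_iff_open:
  "lower_semicontinuous X \<longleftrightarrow> (\<forall>a. open {\<omega>. a < X \<omega>})"
proof
  assume X: "lower_semicontinuous X"
  show "\<forall>a. open {\<omega>. a < X \<omega>}"
  proof
    fix a
    have "\<exists>S. open S \<and> \<omega> \<in> S \<and> S \<subseteq> {\<omega>. a < X \<omega>}" if "\<omega> \<in> {\<omega>. a < X \<omega>}" for \<omega>
    proof -
      have "\<forall>\<^sub>F \<eta> in nhds \<omega>. a < X \<eta>"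
        using X that by (simp add: lower_semicontinuous_def)
      then obtain S where "open S" "\<omega> \<in> S" "\<forall>\<eta>\<in>S. a < X \<eta>"
        by (auto simp: eventually_nhds)
      then show ?thesis by (intro exI[of _ S]) auto
    qed
    then show "open {\<omega>. a < X \<omega>}" by (rule Topological_Spaces.openI)
  qed
next
  assume *: "\<forall>a. open {\<omega>. a < X \<omega>}"
  show "lower_semicontinuous X"
    unfolding lower_semicontinuous_def
  proof (intro allI impI)
    fix \<omega> a assume "a < X \<omega>"
    then show "\<forall>\<^sub>F \<eta> in nhds \<omega>. a < X \<eta>"
      using * eventually_nhds_in_open[of "{\<omega>. a < X \<omega>}" \<omega>] by simp
  qed
qed

definition Lb :: "('a::topological_space \<Rightarrow> real) set" where
  "Lb = {X. lower_semicontinuous X \<and> bounded (range X)}"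

(* Maps on Lb are total functions here; only their values on Lb are constrained. *)

definition default_risk_measure :: "(('a::topological_space \<Rightarrow> real) \<Rightarrow> real) \<Rightarrow> bool" where
  "default_risk_measure \<rho> \<longleftrightarrow>
     (\<forall>X\<in>Lb. \<rho> X \<in> {0..1}) \<and>
     (\<forall>X\<in>Lb. \<forall>Y\<in>Lb. (\<forall>\<omega>. X \<omega> \<le> Y \<omega>) \<longrightarrow> \<rho> X \<le> \<rho> Y) \<and>
     \<rho> (\<lambda>_. 0) = 0 \<and>
     (\<forall>m>0. \<rho> (\<lambda>_. m) = 1)"

definition submodular :: "(('a::topological_space \<Rightarrow> real) \<Rightarrow> real) \<Rightarrow> bool" where
  "submodular \<rho> \<longleftrightarrow>
     (\<forall>X\<in>Lb. \<forall>Y\<in>Lb.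
        \<rho> (\<lambda>\<omega>. min (X \<omega>) (Y \<omega>)) + \<rho> (\<lambda>\<omega>. max (X \<omega>) (Y \<omega>)) \<le> \<rho> X + \<rho> Y)"

definition increases_to :: "(nat \<Rightarrow> 'a \<Rightarrow> real) \<Rightarrow> ('a \<Rightarrow> real) \<Rightarrow> bool" where
  "increases_to Xs X \<longleftrightarrow>
     (\<forall>n \<omega>. Xs n \<omega> \<le> Xs (Suc n) \<omega>) \<and> (\<forall>\<omega>. (\<lambda>n. Xs n \<omega>) \<longlonglongrightarrow> X \<omega>)"

definition continuous_from_below :: "(('a::topological_space \<Rightarrow> real) \<Rightarrow> real) \<Rightarrow> bool" where
  "continuous_from_below \<rho> \<longleftrightarrow>
     (\<forall>Xs. \<forall>X\<in>Lb. (\<forall>n. Xs n \<in> Lb) \<longrightarrow> increases_to Xs X \<longrightarrow> (\<lambda>n. \<rho> (Xs n)) \<longlonglongrightarrow> \<rho> X)"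

end

theory Submission
  imports Defs
begin

text \<open>Submodularity applied to \<open>X\<close> and \<open>0\<close> gives \<open>\<rho> X = c {X > 0}\<close> with the set function
  \<open>c V = \<rho> 1\<^sub>V\<close> on open sets, so everything reduces to finding, for an open \<open>U\<close> and \<open>e > 0\<close>, a Borel
  probability measure \<open>Q\<close> with \<open>Q \<le> c\<close> on open sets and \<open>Q U \<ge> c U - e\<close>. Continuity from below and
  completeness give compact sets \<open>K\<^sub>0 \<subseteq> U\<close> and \<open>K\<^sub>0 \<subseteq> K\<^sub>1 \<subseteq> \<dots>\<close> all of whose open neighbourhoods have
  \<open>c\<close>-value at least \<open>c U - e\<close> and at least a quantity tending to \<open>1\<close>, respectively. The outer
  extension of \<open>c\<close> is submodular on all sets; a minimal submodular function below it that agrees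
  with it on the chain of compact sets is a finitely additive \<open>m\<close>. The inner compact regularization
  of \<open>m\<close> on open sets generates an outer measure whose restriction \<open>Q\<close> to the Borel sets is countably
  additive, and the chain of compact sets prevents any loss of mass.\<close>

section \<open>Finitely additive minorants of submodular set functions\<close>

text \<open>Modularity of the minimal \<open>m\<close> is a bootstrap. As soon as
  \<open>?r A\<close> agrees with \<open>m\<close> on the chain, it competes with \<open>m\<close>,
  and minimality gives \<open>?r A = m\<close>, which is modularity of \<open>m\<close> against
  \<open>A\<close>. Agreement is clear when \<open>A\<close> belongs to the chain, and that case
  yields agreement for arbitrary \<open>A\<close>.\<close>

lemma additive_minorant_exact_on_chain:
  fixes c :: "'a set \<Rightarrow> real"
  assumes c_empty: "c {} = 0" and c_mono: "mono c"
    and c_submod: "\<And>A B. c (A \<union> B) + c (A \<inter> B) \<le> c A + c B"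
    and chain: "\<forall>K\<in>\<K>. \<forall>L\<in>\<K>. K \<subseteq> L \<or> L \<subseteq> K"
  obtains m where "m {} = 0" "mono m" "\<And>A B. m (A \<union> B) + m (A \<inter> B) = m A + m B"
    "m \<le> c" "\<And>K. K \<in> \<K> \<Longrightarrow> m K = c K"
proof -
  define S where "S = {f. f {} = 0 \<and> mono f \<and> (\<forall>A B. f (A \<union> B) + f (A \<inter> B) \<le> f A + f B) \<and>
    f \<le> c \<and> (\<forall>K\<in>\<K>. f K = c K)}"
  have S_D: "f {} = 0" "mono f" "f (A \<union> B) + f (A \<inter> B) \<le> f A + f B" "f \<le> c"
    "K \<in> \<K> \<Longrightarrow> f K = c K" if "f \<in> S" for f A B K
    using that by (auto simp: S_def)
  have nonneg: "0 \<le> f A" if "f \<in> S" for f A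
    using S_D(1)[OF that] monoD[OF S_D(2)[OF that], of "{}" A] by simp
  have c_S: "c \<in> S" using assms by (simp add: S_def)
  have "\<exists>m\<in>S. \<forall>f\<in>S. f \<le> m \<longrightarrow> f = m"
  proof (rule predicate_Zorn)
    \<comment> \<open>The order is reversed, so chains are bounded by their pointwise infima and a
      maximal element is a minimal function.\<close>
    show "partial_order_on S (relation_of (\<lambda>f g. g \<le> f) S)"
      by (rule partial_order_on_relation_ofI) auto
    fix C assume "C \<in> Chains (relation_of (\<lambda>f g. g \<le> f) S)"
    then have C: "f \<in> S" "f \<le> g \<or> g \<le> f" if "f \<in> C" "g \<in> C" for f g
      using that by (auto simp: Chains_def relation_of_def)
    show "\<exists>u\<in>S. \<forall>f\<in>C. u \<le> f"
    proof (cases "C = {}")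
      case True
      then show ?thesis using c_S by auto
    next
      case False
      define u where "u A = (INF f\<in>C. f A)" for A
      have u_le: "u A \<le> f A" if "f \<in> C" for f A
        unfolding u_def using nonneg C(1) that by (intro cINF_lower bdd_belowI2[of _ 0]) auto
      have u_ge: "b \<le> u A" if "\<And>f. f \<in> C \<Longrightarrow> b \<le> f A" for A b
        unfolding u_def using False that by (intro cINF_greatest)
      obtain f0 where f0: "f0 \<in> C" using False by auto
      have u_const: "u A = b" if "\<And>f. f \<in> C \<Longrightarrow> f A = b" for A b
        using f0 that u_le[OF f0, of A] u_ge[of b A] by (metis order.antisym order.refl)
      have submod: "u (A \<union> B) + u (A \<inter> B) \<le> u A + u B" for A B
      proof -
        \<comment> \<open>The infima at \<open>A\<close> and at \<open>B\<close> may be approached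
          along different members \<open>f\<close> and \<open>g\<close> of the chain; the smaller of
          the two serves both.\<close>
        have *: "u (A \<union> B) + u (A \<inter> B) \<le> f A + g B" if fg: "f \<in> C" "g \<in> C" for f g
        proof -
          obtain h where h: "h \<in> C" "h \<le> f" "h \<le> g" using C(2)[OF fg] fg by blast
          have "u (A \<union> B) + u (A \<inter> B) \<le> h (A \<union> B) + h (A \<inter> B)"
            using u_le[OF h(1)] by (simp add: add_mono)
          also have "\<dots> \<le> h A + h B" using S_D(3) C(1) h(1) by blast
          also have "\<dots> \<le> f A + g B" using h(2,3) by (intro add_mono) (auto simp: le_fun_def)
          finally show ?thesis .
        qed
        have "u (A \<union> B) + u (A \<inter> B) - f A \<le> u B" if "f \<in> C" for f
          using *[OF that] by (intro u_ge) (simp add: algebra_simps)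
        then have "u (A \<union> B) + u (A \<inter> B) - u B \<le> u A"
          by (intro u_ge) (simp add: algebra_simps)
        then show ?thesis by simp
      qed
      have "mono u"
      proof (rule monoI)
        fix A B :: "'a set" assume "A \<subseteq> B"
        show "u A \<le> u B"
        proof (rule u_ge)
          fix f assume f: "f \<in> C"
          show "u A \<le> f B"
            using u_le[OF f, of A] monoD[OF S_D(2)[OF C(1)[OF f f]] \<open>A \<subseteq> B\<close>] by simp
        qed
      qed
      moreover have "u \<le> c"
        using u_le[OF f0] S_D(4)[OF C(1)[OF f0 f0]] by (auto simp: le_fun_def intro: order_trans)
      moreover have "u {} = 0" by (rule u_const) (use C(1) S_D(1) in blast)
      moreover have "\<forall>K\<in>\<K>. u K = c K" by (intro ballI u_const) (use C(1) S_D(5) in blast)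
      ultimately have "u \<in> S" using submod by (auto simp: S_def)
      then show ?thesis using u_le by (auto simp: le_fun_def)
    qed
  qed
  then obtain m where m: "m \<in> S" and minimal: "\<And>f. f \<in> S \<Longrightarrow> f \<le> m \<Longrightarrow> f = m" by blast
  note mD = S_D[OF m]
  \<comment> \<open>Passing from \<open>m\<close> to \<open>?r A\<close> keeps submodularity and makes it modular with respect to \<open>A\<close>.\<close>
  let ?r = "\<lambda>A V. m (V \<union> A) + m (V \<inter> A) - m A"
  have r_eq: "?r A = m" if exact: "\<And>K. K \<in> \<K> \<Longrightarrow> ?r A K = m K" for A
  proof (rule minimal)
    show le: "?r A \<le> m" using mD(3) by (auto simp: le_fun_def algebra_simps)
    have "?r A (V \<union> W) + ?r A (V \<inter> W) \<le> ?r A V + ?r A W" for V W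
    proof -
      have "m ((V \<union> W) \<union> A) + m ((V \<inter> W) \<union> A) \<le> m (V \<union> A) + m (W \<union> A)"
      proof -
        have "(V \<union> A) \<union> (W \<union> A) = (V \<union> W) \<union> A" "(V \<union> A) \<inter> (W \<union> A) = (V \<inter> W) \<union> A" by auto
        then show ?thesis using mD(3)[of "V \<union> A" "W \<union> A"] by simp
      qed
      moreover have "m ((V \<union> W) \<inter> A) + m ((V \<inter> W) \<inter> A) \<le> m (V \<inter> A) + m (W \<inter> A)"
      proof -
        have "(V \<inter> A) \<union> (W \<inter> A) = (V \<union> W) \<inter> A" "(V \<inter> A) \<inter> (W \<inter> A) = (V \<inter> W) \<inter> A" by auto
        then show ?thesis using mD(3)[of "V \<inter> A" "W \<inter> A"] by simp
      qed
      ultimately show ?thesis by simp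
    qed
    moreover have "mono (?r A)"
    proof (rule monoI)
      fix V W :: "'a set" assume "V \<subseteq> W"
      then show "?r A V \<le> ?r A W"
        using monoD[OF mD(2), of "V \<union> A" "W \<union> A"] monoD[OF mD(2), of "V \<inter> A" "W \<inter> A"]
        by fastforce
    qed
    moreover have "?r A \<le> c" using le mD(4) by (rule order_trans)
    moreover have "\<forall>K\<in>\<K>. ?r A K = c K" using exact mD(5) by simp
    ultimately show "?r A \<in> S" using mD(1) unfolding S_def by simp
  qed
  have mod_chain: "?r K = m" if "K \<in> \<K>" for K
  proof (rule r_eq)
    fix L assume "L \<in> \<K>"
    \<comment> \<open>The union and intersection of comparable sets are the two sets themselves, so
      \<open>?r K L\<close> collapses to \<open>m L\<close>.\<close>
    with chain that have "K \<subseteq> L \<or> L \<subseteq> K" by blast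
    then show "?r K L = m L"
      by (auto simp: Un_absorb1 Un_absorb2 Int_absorb1 Int_absorb2)
  qed
  have "?r A = m" for A
  proof (rule r_eq)
    fix K assume "K \<in> \<K>"
    \<comment> \<open>The modular identity is symmetric in its two sets: \<open>?r K A = m A\<close>
      rearranges to \<open>?r A K = m K\<close>.\<close>
    from fun_cong[OF mod_chain[OF this], of A] show "?r A K = m K"
      by (simp add: Un_commute Int_commute)
  qed
  then have "m (A \<union> B) + m (A \<inter> B) = m A + m B" for A B
    using fun_cong[of "?r B" m A] by simp
  then show thesis using that mD by blast
qed

section \<open>From a finitely additive set function to a Borel measure\<close>

text \<open>Each point of \<open>K\<close> is the centre of a closed ball inside some
  \<open>V i\<close>. Finitely many of the open balls cover \<open>K\<close>, and grouping the
  closed ones by the chosen index gives the compact pieces. Finite subadditivity of a charge can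
  thus handle countable open covers.\<close>

lemma compact_Union_split:
  fixes K :: "'a::metric_space set"
  assumes K: "compact K" and V: "\<And>i. open (V i)" and sub: "K \<subseteq> (\<Union>i. V i)"
  obtains I L where "finite I" "\<And>i. compact (L i)" "\<And>i. L i \<subseteq> V i" "K = (\<Union>i\<in>I. L i)"
proof -
  have "\<exists>i e. 0 < e \<and> cball x e \<subseteq> V i" if "x \<in> K" for x
    using sub that V open_contains_cball by blast
  then obtain i e where ie: "\<And>x. x \<in> K \<Longrightarrow> 0 < e x \<and> cball x (e x) \<subseteq> V (i x)" by metis
  from K obtain F where F: "F \<subseteq> K" "finite F" "K \<subseteq> (\<Union>x\<in>F. ball x (e x))"
    by (rule compactE_image[where C = K and f = "\<lambda>x. ball x (e x)"]) (use ie in force)+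
  define L where "L j = K \<inter> (\<Union>x\<in>{x\<in>F. i x = j}. cball x (e x))" for j
  show thesis
  proof (rule that[of "i ` F" L])
    show "compact (L j)" for j
      unfolding L_def using K F(2) by (intro compact_Int_closed closed_UN) auto
    show "L j \<subseteq> V j" for j using ie F(1) unfolding L_def by blast
    show "K = (\<Union>j\<in>i ` F. L j)"
      using F(3) by (fastforce simp: L_def)
  qed (use F in simp)
qed

lemma charge_finite_Union_le:
  fixes m :: "'a set \<Rightarrow> real"
  assumes "m {} = 0" "mono m" "\<And>A B. m (A \<union> B) + m (A \<inter> B) = m A + m B" "finite I"
  shows "m (\<Union>i\<in>I. L i) \<le> (\<Sum>i\<in>I. m (L i))"
  using assms(4)
proof induction
  case (insert i I)
  have "0 \<le> m (L i \<inter> (\<Union>i\<in>I. L i))"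
    using monoD[OF assms(2), of "{}"] assms(1) by simp
  then show ?case using insert assms(3)[of "L i" "\<Union>i\<in>I. L i"] by simp
qed (simp add: assms(1))

text \<open>Caratheodory's construction: \<open>\<nu>\<close> is the inner compact regularization of
  \<open>m\<close>, \<open>\<mu>\<close> the outer measure it generates, and the two agree on open
  sets. Open sets are measurable because \<open>m\<close> adds over disjoint compact sets.
  \<open>Q\<close> may carry less mass than \<open>m\<close>, as only compact subsets count.\<close>

lemma compact_regular_measure_from_charge:
  fixes m :: "'a::metric_space set \<Rightarrow> real"
  assumes m_empty: "m {} = 0" and m_mono: "mono m"
    and m_add: "\<And>A B. m (A \<union> B) + m (A \<inter> B) = m A + m B"
  obtains Q where "sets Q = sets borel"
    "\<And>V. open V \<Longrightarrow> emeasure Q V = (SUP K\<in>{K. compact K \<and> K \<subseteq> V}. ennreal (m K))"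
proof -
  define \<nu> where "\<nu> V = (SUP K\<in>{K. compact K \<and> K \<subseteq> V}. ennreal (m K))" for V
  define \<mu> where "\<mu> E = (INF V\<in>{V. open V \<and> E \<subseteq> V}. \<nu> V)" for E
  have m_nonneg: "0 \<le> m A" for A using monoD[OF m_mono, of "{}" A] m_empty by simp
  have \<nu>_ge: "ennreal (m K) \<le> \<nu> V" if "compact K" "K \<subseteq> V" for K V
    unfolding \<nu>_def using that by (intro SUP_upper) auto
  have \<nu>_mono: "\<nu> V \<le> \<nu> W" if "V \<subseteq> W" for V W
    unfolding \<nu>_def using that by (intro SUP_subset_mono) auto
  have \<mu>_le: "\<mu> E \<le> \<nu> V" if "open V" "E \<subseteq> V" for E V
    unfolding \<mu>_def using that by (intro INF_lower) auto
  have \<mu>_open: "\<mu> V = \<nu> V" if "open V" for V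
    using that by (intro antisym \<mu>_le) (auto simp: \<mu>_def intro!: INF_greatest \<nu>_mono)
  have \<mu>_mono: "\<mu> E \<le> \<mu> F" if "E \<subseteq> F" for E F
    unfolding \<mu>_def using that by (intro INF_superset_mono) auto
  \<comment> \<open>Finiteness is what allows each infimum \<open>\<mu> (A n)\<close> to be
    approximated within a positive tolerance below.\<close>
  have \<mu>_fin: "\<mu> E \<noteq> \<infinity>" for E
  proof -
    have "\<mu> E \<le> \<nu> UNIV" by (rule \<mu>_le) auto
    also have "\<dots> \<le> ennreal (m UNIV)"
      unfolding \<nu>_def using monoD[OF m_mono] by (intro SUP_least ennreal_leI) auto
    finally show ?thesis by (auto simp: top_unique)
  qed
  have \<nu>_subadd: "\<nu> (\<Union>i. V i) \<le> (\<Sum>i. \<nu> (V i))" if V: "\<And>i. open (V i)" for V :: "nat \<Rightarrow> 'a set"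
    unfolding \<nu>_def[of "\<Union>i. V i"]
  proof (rule SUP_least, clarify)
    fix K assume K: "compact K" "K \<subseteq> (\<Union>i. V i)"
    obtain I L where L: "finite I" "\<And>i. compact (L i)" "\<And>i. L i \<subseteq> V i" "K = (\<Union>i\<in>I. L i)"
      using compact_Union_split[OF K(1) V K(2)] by metis
    have "ennreal (m K) \<le> ennreal (\<Sum>i\<in>I. m (L i))"
      unfolding L(4) by (intro ennreal_leI charge_finite_Union_le assms L(1))
    also have "\<dots> = (\<Sum>i\<in>I. ennreal (m (L i)))" using m_nonneg by simp
    also have "\<dots> \<le> (\<Sum>i\<in>I. \<nu> (V i))" using L by (intro sum_mono \<nu>_ge) auto
    also have "\<dots> \<le> (\<Sum>i. \<nu> (V i))" using L(1) by (intro sum_le_suminf) auto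
    finally show "ennreal (m K) \<le> (\<Sum>i. \<nu> (V i))" .
  qed
  have csub: "countably_subadditive (Pow UNIV) \<mu>"
    unfolding countably_subadditive_def
  proof (intro allI impI)
    fix A :: "nat \<Rightarrow> 'a set"
    show "\<mu> (\<Union>i. A i) \<le> (\<Sum>i. \<mu> (A i))"
    proof (rule ennreal_le_epsilon)
      fix e :: real assume "0 < e"
      have "\<exists>V\<in>{V. open V \<and> A n \<subseteq> V}. \<nu> V < \<mu> (A n) + ennreal (e * (1/2) ^ Suc n)" for n
        using \<open>0 < e\<close> \<mu>_fin[of "A n"] unfolding \<mu>_def by (intro INF_approx_ennreal) auto
      then obtain V where V: "open (V n)" "A n \<subseteq> V n"
        "\<nu> (V n) < \<mu> (A n) + ennreal (e * (1/2) ^ Suc n)" for n by simp metis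
      have "\<mu> (\<Union>i. A i) \<le> \<nu> (\<Union>i. V i)" using V by (intro \<mu>_le) auto
      also have "\<dots> \<le> (\<Sum>i. \<nu> (V i))" by (rule \<nu>_subadd) (rule V)
      also have "\<dots> \<le> (\<Sum>n. \<mu> (A n) + ennreal (e * (1/2) ^ Suc n))"
        using V(3) by (intro suminf_le summableI less_imp_le)
      also have "\<dots> = (\<Sum>n. \<mu> (A n)) + (\<Sum>n. ennreal e * ennreal ((1/2) ^ Suc n))"
        using \<open>0 < e\<close> by (subst suminf_add[symmetric])
          (auto simp del: ennreal_suminf_cmult simp add: ennreal_mult[symmetric])
      also have "\<dots> = (\<Sum>n. \<mu> (A n)) + e"
        unfolding ennreal_suminf_cmult
        by (subst suminf_ennreal_eq[OF zero_le_power power_half_series]) auto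
      finally show "\<mu> (\<Union>i. A i) \<le> (\<Sum>n. \<mu> (A n)) + e" .
    qed
  qed
  have "\<mu> {} = 0" unfolding \<mu>_open[OF open_empty] \<nu>_def by (simp add: m_empty)
  then have outer: "outer_measure_space (Pow UNIV) \<mu>"
    using csub \<mu>_mono by (auto simp: outer_measure_space_def positive_def increasing_def)
  interpret P: sigma_algebra "UNIV :: 'a set" "Pow UNIV" by (rule sigma_algebra_Pow)
  have sub: "\<mu> E \<le> \<mu> (E \<inter> V) + \<mu> (E - V)" for E V
  proof -
    have "subadditive (Pow UNIV) \<mu>"
      using outer unfolding outer_measure_space_def
      by (blast intro: P.countably_subadditive_subadditive)
    then have "\<mu> ((E \<inter> V) \<union> (E - V)) \<le> \<mu> (E \<inter> V) + \<mu> (E - V)"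
      by (intro subadditiveD) auto
    then show ?thesis by (simp add: Int_Diff_Un)
  qed
  let ?L = "lambda_system UNIV (Pow UNIV) \<mu>"
  have open_L: "V \<in> ?L" if V: "open V" for V
  proof -
    have "\<mu> (E \<inter> V) + \<mu> (E - V) \<le> \<mu> E" for E
      unfolding \<mu>_def[of E]
    proof (rule INF_greatest, clarify)
      fix W assume W: "open W" "E \<subseteq> W"
      \<comment> \<open>Exhaust \<open>W \<inter> V\<close> by compact sets \<open>K\<close>. For
        each, \<open>W - K\<close> is open and contains \<open>W - V\<close>, and any compact
        \<open>L\<close> inside it is disjoint from \<open>K\<close>, so
        \<open>m K + m L = m (K \<union> L)\<close> with \<open>K \<union> L\<close> a compact
        subset of \<open>W\<close>.\<close>
      have "\<mu> (E \<inter> V) + \<mu> (E - V) \<le> \<nu> (W \<inter> V) + \<mu> (W - V)"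
        using V W by (intro add_mono \<mu>_le \<mu>_mono) auto
      also have "\<dots> = (SUP K\<in>{K. compact K \<and> K \<subseteq> W \<inter> V}. ennreal (m K) + \<mu> (W - V))"
        unfolding \<nu>_def by (rule ennreal_SUP_add_left[symmetric]) auto
      also have "\<dots> \<le> \<nu> W"
      proof (rule SUP_least, clarify)
        fix K assume K: "compact K" "K \<subseteq> W \<inter> V"
        have "\<mu> (W - V) \<le> \<nu> (W - K)"
          using K W by (intro \<mu>_le open_Diff compact_imp_closed) auto
        then have "ennreal (m K) + \<mu> (W - V) \<le> ennreal (m K) + \<nu> (W - K)" by (rule add_left_mono)
        also have "\<dots> = (SUP L\<in>{L. compact L \<and> L \<subseteq> W - K}. ennreal (m K) + ennreal (m L))"
          unfolding \<nu>_def by (rule ennreal_SUP_add_right) auto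
        also have "\<dots> \<le> \<nu> W"
        proof (rule SUP_least, clarify)
          fix L assume L: "compact L" "L \<subseteq> W - K"
          then have "K \<inter> L = {}" by auto
          then have "ennreal (m K) + ennreal (m L) = ennreal (m (K \<union> L))"
            using m_add[of K L] m_nonneg m_empty by (simp flip: ennreal_plus)
          also have "\<dots> \<le> \<nu> W" using K L by (intro \<nu>_ge) auto
          finally show "ennreal (m K) + ennreal (m L) \<le> \<nu> W" .
        qed
        finally show "ennreal (m K) + \<mu> (W - V) \<le> \<nu> W" .
      qed
      finally show "\<mu> (E \<inter> V) + \<mu> (E - V) \<le> \<nu> W" .
    qed
    then show ?thesis
      unfolding P.lambda_system_eq using sub by (auto intro: antisym)
  qed
  have ms: "measure_space UNIV ?L \<mu>" using outer by (rule P.caratheodory_lemma)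
  then have "sigma_algebra UNIV ?L" by (simp add: measure_space_def)
  then have "sigma_sets UNIV (Collect open) \<subseteq> ?L"
    by (rule sigma_algebra.sigma_sets_subset) (use open_L in auto)
  then have sets_L: "sets borel \<subseteq> ?L" by (simp add: borel_def)
  have "measure_space UNIV (sets borel) \<mu>"
    using ms sets_L sets.sigma_algebra_axioms[of "borel :: 'a measure"]
    by (auto simp: measure_space_def positive_def countably_additive_def subset_eq)
  then have "emeasure (measure_of UNIV (sets borel) \<mu>) V = \<nu> V" if "open V" for V
    using that by (simp add: \<mu>_open emeasure_measure_of_sigma measure_space_def)
  then show thesis
    using that[of "measure_of UNIV (sets borel) \<mu>"] unfolding \<nu>_def
    by (metis sets.sigma_sets_eq sets_measure_of space_borel subset_Pow_Union Pow_UNIV subset_UNIV)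
qed

section \<open>Compact approximation of open sets in a Polish space\<close>

lemma compact_closure_totally_bounded:
  fixes S :: "'a::complete_space set"
  assumes "\<And>e. 0 < e \<Longrightarrow> \<exists>F. finite F \<and> S \<subseteq> (\<Union>x\<in>F. ball x e)"
  shows "compact (closure S)"
  unfolding compact_eq_totally_bounded complete_eq_closed
proof (intro conjI allI impI)
  fix e :: real assume e: "0 < e"
  then obtain F where F: "finite F" "S \<subseteq> (\<Union>x\<in>F. ball x (e / 2))"
    using assms[of "e / 2"] by auto
  have "closure S \<subseteq> (\<Union>x\<in>F. cball x (e / 2))"
  proof (rule closure_minimal)
    have "(\<Union>x\<in>F. ball x (e / 2)) \<subseteq> (\<Union>x\<in>F. cball x (e / 2))"
      by (intro UN_mono ball_subset_cball subset_refl)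
    with F(2) show "S \<subseteq> (\<Union>x\<in>F. cball x (e / 2))" by (rule subset_trans)
  qed (use F(1) in auto)
  also have "\<dots> \<subseteq> (\<Union>x\<in>F. ball x e)"
    using e by (intro UN_mono subset_refl) auto
  finally show "\<exists>F. finite F \<and> closure S \<subseteq> (\<Union>x\<in>F. ball x e)" using F(1) by blast
qed simp

text \<open>By second countability, \<open>W\<close> is a countable union of balls of radius below
  \<open>r\<close> whose closed versions lie in \<open>W\<close>. Finite unions of them increase to
  \<open>W\<close>, and continuity of \<open>c\<close> selects one with small loss. This is one
  stage of the construction of a compact set.\<close>

lemma open_shrink_totally_bounded:
  fixes c :: "'a::{metric_space,second_countable_topology} set \<Rightarrow> real"
  assumes cont: "\<forall>V. (\<forall>n. open (V n)) \<longrightarrow> incseq V \<longrightarrow> (\<lambda>n. c (V n)) \<longlonglongrightarrow> c (\<Union>n. V n)"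
    and W: "open W" and "0 < r" "0 < d"
  obtains W' F where "open W'" "closure W' \<subseteq> W" "finite F" "W' \<subseteq> (\<Union>x\<in>F. ball x r)"
    "c W - d < c W'"
proof -
  define B where "B = {q. snd q < r \<and> cball (fst q) (snd q) \<subseteq> W}"
  define b where "b q = ball (fst q) (snd q)" for q :: "'a \<times> real"
  obtain \<B> where \<B>: "\<B> \<subseteq> b ` B" "countable \<B>" "\<Union>\<B> = \<Union>(b ` B)"
    by (rule Lindelof[of "b ` B"]) (auto simp: b_def)
  then obtain B' where B': "countable B'" "B' \<subseteq> B" "\<B> = b ` B'"
    by (meson countable_subset_image)
  have b_cball: "b q \<subseteq> cball (fst q) (snd q)" for q by (auto simp: b_def)
  have "\<Union>(b ` B) = W"
  proof
    show "\<Union>(b ` B) \<subseteq> W" using b_cball unfolding B_def by blast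
    show "W \<subseteq> \<Union>(b ` B)"
    proof
      fix x assume "x \<in> W"
      then obtain e where e: "0 < e" "cball x e \<subseteq> W" using W open_contains_cball by blast
      have "cball x (min e (r / 2)) \<subseteq> cball x e" by (rule subset_cball) simp
      then have "(x, min e (r / 2)) \<in> B" using \<open>0 < r\<close> e(2) by (auto simp: B_def)
      moreover have "x \<in> b (x, min e (r / 2))" using e(1) \<open>0 < r\<close> by (simp add: b_def)
      ultimately show "x \<in> \<Union>(b ` B)" by blast
    qed
  qed
  then have W_eq: "W = \<Union>(b ` B')" using \<B>(3) B'(3) by simp
  \<comment> \<open>A ball of negative radius is empty; adding one makes the index set nonempty.\<close>
  define p where "p = from_nat_into (insert (undefined, -1) B')"
  have range_p: "range p = insert (undefined, -1) B'"
    unfolding p_def using B'(1) by (intro range_from_nat_into) auto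
  have "insert (undefined, -1) B' \<subseteq> B"
    using B'(2) \<open>0 < r\<close> by (simp add: B_def)
  then have p_B: "p i \<in> B" for i
    using range_p by (metis rangeI subsetD)
  define V where "V n = (\<Union>i<n. b (p i))" for n :: nat
  have openV: "open (V n)" for n by (auto simp: V_def b_def)
  have "incseq V" unfolding V_def by (intro monoI UN_mono) auto
  moreover have "(\<Union>n. V n) = W"
  proof -
    have "(\<Union>n. V n) = (\<Union>i. b (p i))" unfolding V_def by blast
    also have "\<dots> = \<Union>(b ` range p)" by (simp add: image_image)
    also have "\<dots> = \<Union>(b ` B')" unfolding range_p by (simp add: b_def ball_empty)
    finally show ?thesis unfolding W_eq .
  qed
  ultimately have "(\<lambda>n. c (V n)) \<longlonglongrightarrow> c W" using cont openV by metis
  then have "\<forall>\<^sub>F n in sequentially. c W - d < c (V n)"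
    by (rule order_tendstoD(1)) (use \<open>0 < d\<close> in simp)
  then obtain n where n: "c W - d < c (V n)" using eventually_happens by force
  show thesis
  proof (rule that[OF openV[of n] _ _ _ n])
    have "closure (V n) \<subseteq> (\<Union>i<n. cball (fst (p i)) (snd (p i)))"
      unfolding V_def using b_cball by (intro closure_minimal UN_mono closed_UN) auto
    also have "\<dots> \<subseteq> W" using p_B unfolding B_def by blast
    finally show "closure (V n) \<subseteq> W" .
    have "b (p i) \<subseteq> ball (fst (p i)) r" for i
      using p_B[of i] unfolding b_def B_def by (intro subset_ball) simp
    then show "V n \<subseteq> (\<Union>x\<in>(\<lambda>i. fst (p i)) ` {..<n}. ball x r)"
      unfolding V_def by blast
  qed simp
qed

text \<open>A capacitability argument: iterate the shrinking from \<open>U\<close> with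
  geometrically decreasing losses and radii tending to \<open>0\<close>. The intersection
  \<open>K\<close> of the closures is compact by total boundedness, and by a cluster point argument
  every open set around \<open>K\<close> already contains some stage \<open>W n\<close>.\<close>

lemma compact_capacitability_open:
  fixes c :: "'a::polish_space set \<Rightarrow> real"
  assumes c_mono: "\<forall>V W. open V \<longrightarrow> open W \<longrightarrow> V \<subseteq> W \<longrightarrow> c V \<le> c W"
    and cont: "\<forall>V. (\<forall>n. open (V n)) \<longrightarrow> incseq V \<longrightarrow> (\<lambda>n. c (V n)) \<longlonglongrightarrow> c (\<Union>n. V n)"
    and U: "open U" and e: "0 < e"
  obtains K where "compact K" "K \<subseteq> U" "\<And>V. open V \<Longrightarrow> K \<subseteq> V \<Longrightarrow> c U - e \<le> c V"
proof -
  \<comment> \<open>The clause for \<open>n = 0\<close> fixes the starting set; \<open>?Q n\<close>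
    describes the passage from stage \<open>n\<close> to the next, with loss below
    \<open>e / 2 ^ Suc n\<close>.\<close>
  let ?P = "\<lambda>(n::nat) W. open W \<and> (n = 0 \<longrightarrow> W = U)"
  let ?Q = "\<lambda>(n::nat) W W'. closure W' \<subseteq> W \<and> (\<exists>F. finite F \<and> W' \<subseteq> (\<Union>x\<in>F. ball x (1 / real (Suc n)))) \<and>
    c W - e / 2 ^ Suc n < c W'"
  have "\<exists>W. \<forall>n. ?P n (W n) \<and> ?Q n (W n) (W (Suc n))"
  proof (rule dependent_nat_choice)
    fix W n assume "?P n W"
    then have "open W" by simp
    moreover have "0 < 1 / real (Suc n)" "0 < e / 2 ^ Suc n" using e by auto
    ultimately obtain W' F where "open W'" "closure W' \<subseteq> W" "finite F"
      "W' \<subseteq> (\<Union>x\<in>F. ball x (1 / real (Suc n)))" "c W - e / 2 ^ Suc n < c W'"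
      by (rule open_shrink_totally_bounded[OF cont])
    then show "\<exists>W'. ?P (Suc n) W' \<and> ?Q n W W'"
      by (intro exI[of _ W'] exI[of _ F] conjI impI) (simp_all del: of_nat_Suc power_Suc)
  qed (use U in auto)
  then obtain W where PQ: "\<forall>n. ?P n (W n) \<and> ?Q n (W n) (W (Suc n))" ..
  have W: "\<And>n. open (W n)" "W 0 = U" "\<And>n. closure (W (Suc n)) \<subseteq> W n"
    "\<And>n. \<exists>F. finite F \<and> W (Suc n) \<subseteq> (\<Union>x\<in>F. ball x (1 / real (Suc n)))"
    "\<And>n. c (W n) - e / 2 ^ Suc n < c (W (Suc n))"
    using PQ by simp_all
  have W_Suc: "W (Suc n) \<subseteq> W n" for n
    using closure_subset W(3)[of n] by (rule subset_trans)
  have decW: "W n \<subseteq> W k" if "k \<le> n" for k n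
    using W_Suc that by (rule lift_Suc_antimono_le[of W])
  \<comment> \<open>The losses of the first \<open>n\<close> stages add up to
    \<open>e * (1 - 1 / 2 ^ n)\<close>.\<close>
  have "c U - e * (1 - 1 / 2 ^ n) \<le> c (W n)" for n
  proof (induction n)
    case (Suc n)
    then show ?case using W(5)[of n] by (simp add: field_simps)
  qed (simp add: W(2))
  moreover have "c U - e \<le> c U - e * (1 - 1 / 2 ^ n)" for n :: nat
    using e by (simp add: algebra_simps)
  ultimately have c_W: "c U - e \<le> c (W n)" for n
    using order_trans by blast
  have small: "\<exists>n F. finite F \<and> W (Suc n) \<subseteq> (\<Union>x\<in>F. ball x d)" if d: "0 < d" for d
  proof -
    obtain n where n: "1 / real (Suc n) < d" using nat_approx_posE[OF d] .
    obtain F where F: "finite F" "W (Suc n) \<subseteq> (\<Union>x\<in>F. ball x (1 / real (Suc n)))"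
      using W(4)[of n] by auto
    have "(\<Union>x\<in>F. ball x (1 / real (Suc n))) \<subseteq> (\<Union>x\<in>F. ball x d)"
      using n by (intro UN_mono subset_ball) auto
    then show ?thesis using F subset_trans by metis
  qed
  define K where "K = (\<Inter>n. closure (W n))"
  \<comment> \<open>Because \<open>closure (W (Suc n)) \<subseteq> W n\<close>, the intersection is
    closed and yet contained in every open stage.\<close>
  have K_eq: "K = (\<Inter>n. W n)"
  proof
    show "K \<subseteq> (\<Inter>n. W n)" unfolding K_def using W(3) by blast
    show "(\<Inter>n. W n) \<subseteq> K" unfolding K_def using closure_subset by blast
  qed
  show thesis
  proof (rule that)
    have "compact (closure K)"
    proof (rule compact_closure_totally_bounded)
      fix d :: real assume "0 < d"
      from small[OF this] show "\<exists>F. finite F \<and> K \<subseteq> (\<Union>x\<in>F. ball x d)"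
        unfolding K_eq by blast
    qed
    moreover have "closed K" unfolding K_def by auto
    ultimately show "compact K" by simp
    show "K \<subseteq> U" using W(2) K_eq by auto
    fix V assume V: "open V" "K \<subseteq> V"
    have "\<exists>n. W n \<subseteq> V"
    proof (rule ccontr)
      assume "\<not> ?thesis"
      then have "\<forall>n. \<exists>x. x \<in> W n - V" by blast
      then obtain x where x: "\<And>n. x n \<in> W n" "\<And>n. x n \<notin> V" by (metis DiffD1 DiffD2)
      have "compact (closure (range x))"
      proof (rule compact_closure_totally_bounded)
        fix d :: real assume d: "0 < d"
        from small[OF this] obtain n F where F: "finite F" "W (Suc n) \<subseteq> (\<Union>x\<in>F. ball x d)"
          by blast
        \<comment> \<open>Only \<open>x 0\<close> to \<open>x n\<close> can lie outside
          \<open>W (Suc n)\<close>; they are covered by balls around themselves.\<close>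
        have "range x \<subseteq> (\<Union>y\<in>F \<union> x ` {..n}. ball y d)"
        proof clarify
          fix k
          show "x k \<in> (\<Union>y\<in>F \<union> x ` {..n}. ball y d)"
          proof (cases "k \<le> n")
            case True
            then have "x k \<in> F \<union> x ` {..n}" by simp
            moreover have "x k \<in> ball (x k) d" using d by simp
            ultimately show ?thesis by (rule UN_I)
          next
            case False
            then have "x k \<in> W (Suc n)" using x(1)[of k] decW[of "Suc n" k] by auto
            then have "x k \<in> (\<Union>x\<in>F. ball x d)" using F(2) by (rule subsetD[rotated])
            then show ?thesis unfolding UN_Un by (rule UnI1)
          qed
        qed
        then show "\<exists>F. finite F \<and> range x \<subseteq> (\<Union>y\<in>F. ball y d)"
          using F(1) by (intro exI[of _ "F \<union> x ` {..n}"]) auto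
      qed
      then have "seq_compact (closure (range x))" by (rule compact_imp_seq_compact)
      moreover have "\<forall>n. x n \<in> closure (range x)"
        by (intro allI subsetD[OF closure_subset] rangeI)
      ultimately obtain l g where g: "strict_mono g" "(x \<circ> g) \<longlonglongrightarrow> l"
        by (rule seq_compactE)
      \<comment> \<open>A tail of the subsequence lies in each \<open>W n\<close>, so the limit lies
        in every closure and hence in \<open>K\<close>, while the closed complement of
        \<open>V\<close> keeps it outside \<open>V\<close>.\<close>
      have "l \<in> closure (W n)" for n
      proof (rule Lim_in_closed_set[OF closed_closure _ _ g(2)])
        have "(x \<circ> g) k \<in> closure (W n)" if "n \<le> k" for k
        proof -
          have "n \<le> g k" using seq_suble[OF g(1), of k] that by simp
          then have "x (g k) \<in> W n" using x(1) decW by blast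
          then show ?thesis using closure_subset by auto
        qed
        then show "\<forall>\<^sub>F k in sequentially. (x \<circ> g) k \<in> closure (W n)"
          by (rule eventually_sequentiallyI)
      qed simp
      then have "l \<in> V" using V(2) unfolding K_def by auto
      moreover have "l \<in> - V"
        using V(1) x(2) by (intro Lim_in_closed_set[OF _ _ _ g(2)]) auto
      ultimately show False by simp
    qed
    then obtain n where "W n \<subseteq> V" ..
    then show "c U - e \<le> c V" using c_W[of n] c_mono W(1) V(1) by (meson order_trans)
  qed
qed

section \<open>Probability measures dominated by the capacity\<close>

text \<open>Domination comes from \<open>m A \<le> d A \<le> c V\<close> for compact
  \<open>A \<subseteq> V\<close>. The lower bounds come from compact sets on which \<open>m\<close>
  equals \<open>d\<close>: \<open>K0\<close> for the mass of \<open>U\<close>, and the sets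
  \<open>K n\<close> for the total mass.\<close>

lemma dominated_probability_nearly_exact:
  fixes c :: "'a::polish_space set \<Rightarrow> real"
  assumes c_empty: "c {} = 0" and c_UNIV: "c UNIV = 1"
    and c_mono: "\<forall>V W. open V \<longrightarrow> open W \<longrightarrow> V \<subseteq> W \<longrightarrow> c V \<le> c W"
    and c_submod: "\<forall>V W. open V \<longrightarrow> open W \<longrightarrow> c (V \<union> W) + c (V \<inter> W) \<le> c V + c W"
    and cont: "\<forall>V. (\<forall>n. open (V n)) \<longrightarrow> incseq V \<longrightarrow> (\<lambda>n. c (V n)) \<longlonglongrightarrow> c (\<Union>n. V n)"
    and U: "open U" and e: "0 < e"
  obtains Q where "prob_space Q" "sets Q = sets borel"
    "\<And>V. open V \<Longrightarrow> measure Q V \<le> c V" "c U - e \<le> measure Q U"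
proof -
  define d where "d A = (INF V\<in>{V. open V \<and> A \<subseteq> V}. c V)" for A
  have c_nonneg: "0 \<le> c V" if "open V" for V using c_mono[rule_format, of "{}" V] that c_empty by simp
  have d_le: "d A \<le> c V" if "open V" "A \<subseteq> V" for A V
    unfolding d_def using that c_nonneg by (intro cINF_lower bdd_belowI2[of _ 0]) auto
  have d_ge: "b \<le> d A" if "\<And>V. open V \<Longrightarrow> A \<subseteq> V \<Longrightarrow> b \<le> c V" for A b
    unfolding d_def using that open_UNIV by (intro cINF_greatest) auto
  have d_open: "d V = c V" if "open V" for V
    using that by (intro antisym d_le d_ge c_mono[rule_format]) auto
  have d_mono: "mono d" by (intro monoI d_ge d_le) auto
  have d_submod: "d (A \<union> B) + d (A \<inter> B) \<le> d A + d B" for A B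
  proof -
    have *: "d (A \<union> B) + d (A \<inter> B) \<le> c V + c W" if "open V" "A \<subseteq> V" "open W" "B \<subseteq> W" for V W
    proof -
      have "d (A \<union> B) + d (A \<inter> B) \<le> c (V \<union> W) + c (V \<inter> W)"
        using that by (intro add_mono d_le) auto
      then show ?thesis using c_submod[rule_format, OF that(1,3)] by simp
    qed
    have "d (A \<union> B) + d (A \<inter> B) - c V \<le> d B" if "open V" "A \<subseteq> V" for V
      using *[OF that] by (intro d_ge) (simp add: algebra_simps)
    then have "d (A \<union> B) + d (A \<inter> B) - d B \<le> d A"
      by (intro d_ge) (simp add: algebra_simps)
    then show ?thesis by simp
  qed
  obtain K0 where K0: "compact K0" "K0 \<subseteq> U" "\<And>V. open V \<Longrightarrow> K0 \<subseteq> V \<Longrightarrow> c U - e \<le> c V"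
    using compact_capacitability_open[OF c_mono cont U e] by metis
  have "\<exists>L. compact L \<and> (\<forall>V. open V \<longrightarrow> L \<subseteq> V \<longrightarrow> 1 - 1 / real (Suc n) \<le> c V)" for n
  proof -
    have "0 < 1 / real (Suc n)" by simp
    from compact_capacitability_open[OF c_mono cont open_UNIV this] show ?thesis
      unfolding c_UNIV by metis
  qed
  then obtain L where L: "\<And>n. compact (L n)"
    "\<And>n V. open V \<Longrightarrow> L n \<subseteq> V \<Longrightarrow> 1 - 1 / real (Suc n) \<le> c V"
    by metis
  \<comment> \<open>Taking unions makes the sets nested, and \<open>K n\<close> inherits the lower
    bound on neighbourhoods from \<open>L n\<close>. \<open>K0\<close> stays in the chain as a
    separate member because it is the one known to lie inside \<open>U\<close>.\<close>
  define K where "K n = K0 \<union> (\<Union>i\<le>n. L i)" for n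
  have K: "compact (K n)" for n
    unfolding K_def using K0(1) L(1) by (intro compact_Un compact_UN) auto
  have K_mono: "K i \<subseteq> K j" if "i \<le> j" for i j
    unfolding K_def using that by (intro Un_mono UN_mono) auto
  have chain: "\<forall>A\<in>insert K0 (range K). \<forall>B\<in>insert K0 (range K). A \<subseteq> B \<or> B \<subseteq> A"
  proof -
    have "K0 \<subseteq> K n" for n by (simp add: K_def)
    moreover have "K i \<subseteq> K j \<or> K j \<subseteq> K i" for i j using K_mono by (meson nle_le)
    ultimately show ?thesis by auto
  qed
  have d_empty: "d {} = 0" using d_open c_empty by simp
  obtain m where m: "m {} = 0" "mono m" "\<And>A B. m (A \<union> B) + m (A \<inter> B) = m A + m B"
    "m \<le> d" "\<And>A. A \<in> insert K0 (range K) \<Longrightarrow> m A = d A"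
    using additive_minorant_exact_on_chain[OF d_empty d_mono d_submod chain] by metis
  obtain Q where Q: "sets Q = sets borel"
    "\<And>V. open V \<Longrightarrow> emeasure Q V = (SUP A\<in>{A. compact A \<and> A \<subseteq> V}. ennreal (m A))"
    using compact_regular_measure_from_charge[OF m(1-3)] by metis
  have Q_le: "emeasure Q V \<le> ennreal (c V)" if "open V" for V
    unfolding Q(2)[OF that]
  proof (rule SUP_least, clarify)
    fix A assume "A \<subseteq> V"
    with m(4) have "m A \<le> c V" using d_le[OF that] by (meson le_fun_def order_trans)
    then show "ennreal (m A) \<le> ennreal (c V)" by (rule ennreal_leI)
  qed
  have space: "space Q = UNIV" using sets_eq_imp_space_eq[OF Q(1)] by simp
  have "emeasure Q (space Q) \<noteq> \<infinity>"
    using Q_le[OF open_UNIV] by (auto simp: space c_UNIV top_unique)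
  then interpret finite_measure Q by (rule finite_measureI)
  have measure_le: "measure Q V \<le> c V" if "open V" for V
    using Q_le[OF that] c_nonneg[OF that] by (simp add: emeasure_eq_measure)
  \<comment> \<open>A chain member \<open>A \<subseteq> V\<close> is compact, so it contributes
    \<open>m A = d A\<close> to the supremum defining \<open>Q\<close> on \<open>V\<close>.\<close>
  have measure_ge: "b \<le> measure Q V"
    if "open V" "A \<in> insert K0 (range K)" "A \<subseteq> V" "\<And>W. open W \<Longrightarrow> A \<subseteq> W \<Longrightarrow> b \<le> c W" for A V b
  proof -
    have "compact A" using that(2) K0(1) K by auto
    have "b \<le> m A" using m(5)[OF that(2)] d_ge[OF that(4)] by simp
    then have "ennreal b \<le> ennreal (m A)" by (rule ennreal_leI)
    also have "\<dots> \<le> emeasure Q V"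
      unfolding Q(2)[OF that(1)] using \<open>compact A\<close> that(3) by (intro SUP_upper) simp
    finally show ?thesis by (simp add: emeasure_eq_measure)
  qed
  have "1 \<le> measure Q UNIV"
  proof (rule ccontr)
    assume "\<not> 1 \<le> measure Q UNIV"
    then have "0 < 1 - measure Q UNIV" by simp
    then obtain n where n: "1 / real (Suc n) < 1 - measure Q UNIV" by (rule nat_approx_posE)
    have "L n \<subseteq> K n" by (auto simp: K_def)
    then have "1 - 1 / real (Suc n) \<le> measure Q UNIV"
      by (intro measure_ge[of _ "K n"] L(2)[of _ n]) auto
    then show False using n by simp
  qed
  then have "prob_space Q"
    using measure_le[OF open_UNIV] c_UNIV
    by (intro prob_spaceI) (simp add: space emeasure_eq_measure)
  moreover have "c U - e \<le> measure Q U"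
    by (rule measure_ge[OF U _ K0(2,3)]) auto
  ultimately show thesis using that Q(1) measure_le by blast
qed

section \<open>Lattice operations and indicators in \<open>Lb\<close>\<close>

lemma Lb_indicator: "open V \<Longrightarrow> (indicator V :: 'a::topological_space \<Rightarrow> real) \<in> Lb"
proof -
  assume V: "open V"
  have "{\<omega>. a < indicator V \<omega>} = (if a < 0 then UNIV else if a < 1 then V else {})" for a :: real
    by (auto simp: indicator_def)
  then have "lower_semicontinuous (indicator V :: 'a \<Rightarrow> real)"
    using V by (simp add: lower_semicontinuous_iff_open)
  moreover have "bounded (range (indicator V :: 'a \<Rightarrow> real))"
    by (rule boundedI[of _ 1]) (auto simp: indicator_def)
  ultimately show ?thesis by (simp add: Lb_def)
qed

lemma Lb_const: "(\<lambda>_. a) \<in> Lb"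
  by (simp add: Lb_def lower_semicontinuous_def)

lemma Lb_max:
  assumes X: "X \<in> Lb" and Y: "Y \<in> Lb"
  shows "(\<lambda>\<omega>. max (X \<omega>) (Y \<omega>)) \<in> Lb"
proof -
  have "{\<omega>. a < max (X \<omega>) (Y \<omega>)} = {\<omega>. a < X \<omega>} \<union> {\<omega>. a < Y \<omega>}" for a
    by auto
  then have "lower_semicontinuous (\<lambda>\<omega>. max (X \<omega>) (Y \<omega>))"
    using assms by (simp add: Lb_def lower_semicontinuous_iff_open open_Un open_Int)
  moreover have "bounded (range (\<lambda>\<omega>. max (X \<omega>) (Y \<omega>)))"
  proof (rule bounded_subset)
    show "bounded (range X \<union> range Y)" using assms by (simp add: Lb_def)
  qed (auto simp: max_def)
  ultimately show ?thesis by (simp add: Lb_def)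
qed

lemma Lb_min:
  assumes X: "X \<in> Lb" and Y: "Y \<in> Lb"
  shows "(\<lambda>\<omega>. min (X \<omega>) (Y \<omega>)) \<in> Lb"
proof -
  have "{\<omega>. a < min (X \<omega>) (Y \<omega>)} = {\<omega>. a < X \<omega>} \<inter> {\<omega>. a < Y \<omega>}" for a
    by auto
  then have "lower_semicontinuous (\<lambda>\<omega>. min (X \<omega>) (Y \<omega>))"
    using assms by (simp add: Lb_def lower_semicontinuous_iff_open open_Un open_Int)
  moreover have "bounded (range (\<lambda>\<omega>. min (X \<omega>) (Y \<omega>)))"
  proof (rule bounded_subset)
    show "bounded (range X \<union> range Y)" using assms by (simp add: Lb_def)
  qed (auto simp: min_def)
  ultimately show ?thesis by (simp add: Lb_def)
qed

section \<open>Continuity from below and representation by probability measures\<close>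

theorem proposition40:
  fixes \<rho> :: "('a::polish_space \<Rightarrow> real) \<Rightarrow> real"
  assumes "default_risk_measure \<rho>"
    and "submodular \<rho>"
    and "\<And>X. X \<in> Lb \<Longrightarrow> (\<forall>\<omega>. 0 \<le> X \<omega>) \<Longrightarrow> \<rho> X = \<rho> (indicator {\<omega>. X \<omega> > 0})"
  shows "continuous_from_below \<rho> \<longleftrightarrow>
    (\<exists>P :: 'a measure set. P \<noteq> {} \<and>
       (\<forall>Q\<in>P. prob_space Q \<and> sets Q = sets borel) \<and>
       (\<forall>X\<in>Lb. \<rho> X = (SUP Q\<in>P. measure Q {\<omega>. X \<omega> > 0})))"
proof -
  have nonneg: "0 \<le> \<rho> X" if "X \<in> Lb" for X
    using assms(1) that by (auto simp: default_risk_measure_def)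
  have mono: "\<rho> X \<le> \<rho> Y" if "X \<in> Lb" "Y \<in> Lb" "\<And>\<omega>. X \<omega> \<le> Y \<omega>" for X Y
    using assms(1) that by (auto simp: default_risk_measure_def)
  have zero: "\<rho> (\<lambda>_. 0) = 0" and one: "\<rho> (\<lambda>_. 1) = 1"
    using assms(1) by (auto simp: default_risk_measure_def)
  have submod: "\<rho> (\<lambda>\<omega>. min (X \<omega>) (Y \<omega>)) + \<rho> (\<lambda>\<omega>. max (X \<omega>) (Y \<omega>)) \<le> \<rho> X + \<rho> Y"
    if "X \<in> Lb" "Y \<in> Lb" for X Y
    using assms(2) that by (auto simp: submodular_def)
  have open_pos: "open {\<omega>. 0 < X \<omega>}" if "X \<in> Lb" for X :: "'a \<Rightarrow> real"
    using that by (simp add: Lb_def lower_semicontinuous_iff_open)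
  define c where "c V = \<rho> (indicator V)" for V
  have \<rho>_eq: "\<rho> X = c {\<omega>. 0 < X \<omega>}" if X: "X \<in> Lb" for X
  proof -
    have "\<rho> (\<lambda>\<omega>. min (X \<omega>) 0) + \<rho> (\<lambda>\<omega>. max (X \<omega>) 0) \<le> \<rho> X"
      using submod[OF X Lb_const[of 0]] zero by simp
    then have "\<rho> (\<lambda>\<omega>. max (X \<omega>) 0) \<le> \<rho> X"
      using nonneg[OF Lb_min[OF X Lb_const[of 0]]] by simp
    moreover have "\<rho> X \<le> \<rho> (\<lambda>\<omega>. max (X \<omega>) 0)"
      by (rule mono[OF X Lb_max[OF X Lb_const[of 0]]]) simp
    moreover have "\<rho> (\<lambda>\<omega>. max (X \<omega>) 0) = c {\<omega>. 0 < max (X \<omega>) 0}"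
      unfolding c_def by (rule assms(3)[OF Lb_max[OF X Lb_const[of 0]]]) simp
    moreover have "{\<omega>. 0 < max (X \<omega>) 0} = {\<omega>. 0 < X \<omega>}" by auto
    ultimately show ?thesis by simp
  qed
  have c_empty: "c {} = 0" and c_UNIV: "c UNIV = 1"
    using zero one by (auto simp: c_def indicator_def[abs_def])
  have c_mono: "\<forall>V W. open V \<longrightarrow> open W \<longrightarrow> V \<subseteq> W \<longrightarrow> c V \<le> c W"
    unfolding c_def by (intro allI impI mono Lb_indicator) (auto simp: indicator_def)
  have c_submod: "\<forall>V W. open V \<longrightarrow> open W \<longrightarrow> c (V \<union> W) + c (V \<inter> W) \<le> c V + c W"
  proof (intro allI impI)
    fix V W :: "'a set" assume "open V" "open W"
    have "(\<lambda>\<omega>. max (indicator V \<omega>) (indicator W \<omega>)) = (indicator (V \<union> W) :: 'a \<Rightarrow> real)"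
      "(\<lambda>\<omega>. min (indicator V \<omega>) (indicator W \<omega>)) = (indicator (V \<inter> W) :: 'a \<Rightarrow> real)"
      by (auto simp: indicator_def)
    then show "c (V \<union> W) + c (V \<inter> W) \<le> c V + c W"
      using submod[OF Lb_indicator Lb_indicator, OF \<open>open V\<close> \<open>open W\<close>] by (simp add: c_def)
  qed
  show ?thesis
  proof
    assume cfb: "continuous_from_below \<rho>"
    have cont: "\<forall>V. (\<forall>n. open (V n)) \<longrightarrow> incseq V \<longrightarrow> (\<lambda>n. c (V n)) \<longlonglongrightarrow> c (\<Union>n. V n)"
    proof (intro allI impI)
      fix V :: "nat \<Rightarrow> 'a set" assume V: "\<forall>n. open (V n)" "incseq V"
      have "increases_to (\<lambda>n. indicator (V n)) (indicator (\<Union>n. V n))"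
        unfolding increases_to_def
      proof (intro conjI allI)
        show "indicator (V n) \<omega> \<le> (indicator (V (Suc n)) \<omega> :: real)" for n \<omega>
          using incseq_SucD[OF V(2), of n] by (auto simp: indicator_def)
        show "(\<lambda>n. indicator (V n) \<omega> :: real) \<longlonglongrightarrow> indicator (\<Union>n. V n) \<omega>" for \<omega>
          using V(2) by (rule LIMSEQ_indicator_incseq)
      qed
      then show "(\<lambda>n. c (V n)) \<longlonglongrightarrow> c (\<Union>n. V n)"
        using cfb V(1) Lb_indicator[of "\<Union>n. V n"] Lb_indicator
        unfolding continuous_from_below_def c_def by (metis open_UN)
    qed
    \<comment> \<open>The largest candidate: all Borel probability measures dominated by
      \<open>c\<close> on open sets. The upper bound for the supremum is then immediate, and
      \<open>ex\<close> supplies the lower bound up to any \<open>e > 0\<close>.\<close>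
    let ?P = "{Q. prob_space Q \<and> sets Q = sets borel \<and> (\<forall>V. open V \<longrightarrow> measure Q V \<le> c V)}"
    have ex: "\<exists>Q\<in>?P. c U - e \<le> measure Q U" if "open U" "0 < e" for U e
      by (rule dominated_probability_nearly_exact[OF c_empty c_UNIV c_mono c_submod cont that]) blast
    have ne: "?P \<noteq> {}" using ex[OF open_UNIV zero_less_one] by blast
    moreover have "\<rho> X = (SUP Q\<in>?P. measure Q {\<omega>. X \<omega> > 0})" if X: "X \<in> Lb" for X
      unfolding \<rho>_eq[OF X]
    proof (rule antisym)
      let ?U = "{\<omega>. X \<omega> > 0}"
      note U = open_pos[OF X]
      show "(SUP Q\<in>?P. measure Q ?U) \<le> c ?U"
        using U by (intro cSUP_least[OF ne]) auto
      have bdd: "bdd_above ((\<lambda>Q. measure Q ?U) ` ?P)"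
        using U by (intro bdd_aboveI2[of _ _ "c ?U"]) auto
      show "c ?U \<le> (SUP Q\<in>?P. measure Q ?U)"
      proof (rule field_le_epsilon)
        fix e :: real assume "0 < e"
        then obtain Q where Q: "Q \<in> ?P" "c ?U - e \<le> measure Q ?U" using ex[OF U] by blast
        then show "c ?U \<le> (SUP Q\<in>?P. measure Q ?U) + e"
          using cSUP_upper[OF Q(1) bdd] by simp
      qed
    qed
    ultimately show "\<exists>P :: 'a measure set. P \<noteq> {} \<and>
       (\<forall>Q\<in>P. prob_space Q \<and> sets Q = sets borel) \<and>
       (\<forall>X\<in>Lb. \<rho> X = (SUP Q\<in>P. measure Q {\<omega>. X \<omega> > 0}))"
      by (intro exI[of _ ?P]) simp
  next
    assume "\<exists>P :: 'a measure set. P \<noteq> {} \<and>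
       (\<forall>Q\<in>P. prob_space Q \<and> sets Q = sets borel) \<and>
       (\<forall>X\<in>Lb. \<rho> X = (SUP Q\<in>P. measure Q {\<omega>. X \<omega> > 0}))"
    then obtain P :: "'a measure set" where P: "P \<noteq> {}"
      "\<forall>Q\<in>P. prob_space Q \<and> sets Q = sets borel"
      "\<forall>X\<in>Lb. \<rho> X = (SUP Q\<in>P. measure Q {\<omega>. X \<omega> > 0})"
      by (elim exE conjE)
    have prob: "prob_space Q" and sets: "sets Q = sets borel" if "Q \<in> P" for Q
      using P(2) that by auto
    note \<rho>_SUP = P(3)[rule_format]
    \<comment> \<open>Real suprema need this bound before they can be compared with individual
      members.\<close>
    have bdd: "bdd_above ((\<lambda>Q. measure Q A) ` P)" for A
      using prob by (intro bdd_aboveI2[of _ _ 1] prob_space.prob_le_1)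
    show "continuous_from_below \<rho>"
      unfolding continuous_from_below_def
    proof (intro allI ballI impI)
      fix Xs and X :: "'a \<Rightarrow> real"
      assume X: "X \<in> Lb" and Xs: "\<forall>n. Xs n \<in> Lb" and inc: "increases_to Xs X"
      have incX: "incseq (\<lambda>n. Xs n \<omega>)" and limX: "(\<lambda>n. Xs n \<omega>) \<longlonglongrightarrow> X \<omega>" for \<omega>
        using inc by (auto simp: increases_to_def incseq_Suc_iff)
      let ?A = "\<lambda>n. {\<omega>. Xs n \<omega> > 0}"
      have "incseq ?A"
        using incX by (auto simp: incseq_def intro: less_le_trans)
      have "(\<Union>n. ?A n) = {\<omega>. X \<omega> > 0}"
      proof (intro equalityI subsetI)
        fix \<omega> assume "\<omega> \<in> (\<Union>n. ?A n)"
        then show "\<omega> \<in> {\<omega>. X \<omega> > 0}"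
          using incseq_le[OF incX limX, of _ \<omega>] by (auto intro: less_le_trans)
      next
        fix \<omega> assume "\<omega> \<in> {\<omega>. X \<omega> > 0}"
        then have "\<forall>\<^sub>F n in sequentially. 0 < Xs n \<omega>" using order_tendstoD(1)[OF limX] by simp
        from eventually_happens[OF this] show "\<omega> \<in> (\<Union>n. ?A n)" by auto
      qed
      then have lim: "(\<lambda>n. measure Q (?A n)) \<longlonglongrightarrow> measure Q {\<omega>. X \<omega> > 0}" if Q: "Q \<in> P" for Q
      proof -
        interpret prob_space Q using prob[OF Q] .
        have "range ?A \<subseteq> sets Q" using sets[OF Q] open_pos Xs by auto
        from finite_Lim_measure_incseq[OF this \<open>incseq ?A\<close>] show ?thesis
          unfolding \<open>(\<Union>n. ?A n) = {\<omega>. X \<omega> > 0}\<close> .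
      qed
      \<comment> \<open>Monotonicity bounds the sequence by \<open>\<rho> X\<close>. From below, a
        single \<open>Q\<close> whose value exceeds \<open>a\<close> suffices, as continuity of that
        one measure lifts \<open>\<rho> (Xs n)\<close> above \<open>a\<close> eventually; no
        uniformity over \<open>P\<close> enters.\<close>
      show "(\<lambda>n. \<rho> (Xs n)) \<longlonglongrightarrow> \<rho> X"
      proof (rule order_tendstoI)
        fix a assume "\<rho> X < a"
        moreover have "\<rho> (Xs n) \<le> \<rho> X" for n
          using Xs X incseq_le[OF incX limX] by (intro mono) auto
        ultimately show "\<forall>\<^sub>F n in sequentially. \<rho> (Xs n) < a"
          by (intro always_eventually) (auto intro: le_less_trans)
      next
        fix a assume "a < \<rho> X"
        then obtain Q where Q: "Q \<in> P" "a < measure Q {\<omega>. X \<omega> > 0}"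
          unfolding \<rho>_SUP[OF X] using less_cSUP_iff[OF P(1) bdd] by blast
        show "\<forall>\<^sub>F n in sequentially. a < \<rho> (Xs n)"
          using order_tendstoD(1)[OF lim[OF Q(1)] Q(2)]
        proof eventually_elim
          case (elim n)
          also have "measure Q (?A n) \<le> \<rho> (Xs n)"
            unfolding \<rho>_SUP[OF Xs[rule_format]] by (rule cSUP_upper[OF Q(1) bdd])
          finally show ?case .
        qed
      qed
    qed
  qed
qed

end
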